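(* Let $D=\{x_1,\dots,x_n\}$ be a set of $n$ points of $\mathbb{R}^d$, at least two of which are distinct, and assume that $0<\eta<1-\frac1n$. Let $F:\mathbb{R}^d\to\mathbb{R}$ be defined by $$F(c)=\sum_{i=1}^n \max\Big(0,\ \|x_i-c\|^2-\frac{\eta}{n-1}\sum_{j=1}^n\|x_j-c\|^2\Big),$$ and put $\eta'=\frac{n}{n-1}\eta$. Then $F$ is $2(1-\eta')$-strongly convex on $\mathbb{R}^d$, and a fortiori strictly convex. The problem of minimizing $F$ over $\mathbb{R}^d$ admits exactly one solution.
   Context: $\|\cdot\|$ is the Euclidean norm. For $m>0$, a function $F:\mathbb{R}^d\to\mathbb{R}$ is $m$-strongly convex if $c\mapsto F(c)-\frac m2\|c\|^2$ is convex. *)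

theory Defs
  imports "HOL-Analysis.Analysis"
begin

definition strongly_convex :: "real \<Rightarrow> (real ^ 'd \<Rightarrow> real) \<Rightarrow> bool" where
  "strongly_convex m F \<longleftrightarrow>
     m > 0 \<and> convex_on UNIV (\<lambda>c. F c - m / 2 * (norm c)\<^sup>2)"

definition strictly_convex :: "(real ^ 'd \<Rightarrow> real) \<Rightarrow> bool" where
  "strictly_convex F \<longleftrightarrow>
     (\<forall>a b. \<forall>t. a \<noteq> b \<and> 0 < t \<and> t < 1 \<longrightarrow>
        F ((1 - t) *\<^sub>R a + t *\<^sub>R b) < (1 - t) * F a + t * F b)"

(* The points are a family indexed by {1..n}, so repetitions are allowed;
   values of x outside {1..n} are irrelevant. *)
definition objective :: "nat \<Rightarrow> (nat \<Rightarrow> real ^ 'd) \<Rightarrow> real \<Rightarrow> real ^ 'd \<Rightarrow> real" where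
  "objective n x \<eta> c =
     (\<Sum>i = 1..n. max 0 ((norm (x i - c))\<^sup>2 -
        \<eta> / (real n - 1) * (\<Sum>j = 1..n. (norm (x j - c))\<^sup>2)))"

end

(* Write g i c for the i-th argument of max 0. Each g i is (1 - \<eta>') * (norm c)^2 plus an affine
   function, and the g i add up to (1 - \<eta>') times the sum of the squared distances, which is positive
   because two points differ. So at every convex combination of a and b some g k is positive: there
   max 0 (g k) = g k gains the full quadratic modulus, while the other terms max 0 (g i), being convex,
   lose nothing. The bound of F from below by the sum of the g i gives coercivity, hence a minimizer. *)
theory Submission
  imports Defs
begin

text \<open>Expanding the inner products leaves an exact identity. Exactness matters: squared
  distances later enter with a negative coefficient too, where a mere convexity inequality would
  point the wrong way.\<close>

lemma norm_diff_sq_convex_combination: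
  fixes p a b :: "'a :: real_inner"
  shows "(norm (p - ((1 - t) *\<^sub>R a + t *\<^sub>R b)))\<^sup>2 =
    (1 - t) * (norm (p - a))\<^sup>2 + t * (norm (p - b))\<^sup>2 - t * (1 - t) * (norm (a - b))\<^sup>2"
  by (simp add: power2_norm_eq_inner inner_diff_left inner_diff_right inner_add_left inner_add_right
      inner_commute algebra_simps)

text \<open>The deficit in the hypothesis is exactly that of m times the squared norm (the previous
  identity at the point 0), so subtracting this function cancels it and leaves plain convexity. The
  factor 2 makes up for the m/2 in the definition.\<close>

lemma strongly_convexI:
  fixes F :: "real ^ 'd \<Rightarrow> real"
  assumes "m > 0"
    and ineq: "\<And>a b t. 0 < t \<Longrightarrow> t < 1 \<Longrightarrow> F ((1 - t) *\<^sub>R a + t *\<^sub>R b) \<le>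
      (1 - t) * F a + t * F b - m * (t * (1 - t) * (norm (a - b))\<^sup>2)"
  shows "strongly_convex (2 * m) F"
  unfolding strongly_convex_def
proof (intro conjI convex_onI)
  fix t :: real and a b :: "real ^ 'd"
  assume t: "0 < t" "t < 1"
  have "(norm ((1 - t) *\<^sub>R a + t *\<^sub>R b))\<^sup>2 =
      (1 - t) * (norm a)\<^sup>2 + t * (norm b)\<^sup>2 - t * (1 - t) * (norm (a - b))\<^sup>2"
    by (rule norm_diff_sq_convex_combination[of 0 t a b, unfolded diff_0 norm_minus_cancel])
  then show "F ((1 - t) *\<^sub>R a + t *\<^sub>R b) - 2 * m / 2 * (norm ((1 - t) *\<^sub>R a + t *\<^sub>R b))\<^sup>2 \<le>
      (1 - t) * (F a - 2 * m / 2 * (norm a)\<^sup>2) + t * (F b - 2 * m / 2 * (norm b)\<^sup>2)"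
    using ineq[OF t, of a b] by (simp only:) (simp add: algebra_simps)
qed (use assms in auto)

lemma strictly_convexI:
  fixes F :: "real ^ 'd \<Rightarrow> real"
  assumes "m > 0"
    and ineq: "\<And>a b t. 0 < t \<Longrightarrow> t < 1 \<Longrightarrow> F ((1 - t) *\<^sub>R a + t *\<^sub>R b) \<le>
      (1 - t) * F a + t * F b - m * (t * (1 - t) * (norm (a - b))\<^sup>2)"
  shows "strictly_convex F"
  unfolding strictly_convex_def
proof (intro allI impI)
  fix a b :: "real ^ 'd" and t :: real
  assume *: "a \<noteq> b \<and> 0 < t \<and> t < 1"
  then have "m * (t * (1 - t) * (norm (a - b))\<^sup>2) > 0"
    using \<open>m > 0\<close> by simp
  then show "F ((1 - t) *\<^sub>R a + t *\<^sub>R b) < (1 - t) * F a + t * F b"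
    using ineq[of t a b] * by linarith
qed

text \<open>At the midpoint of two different minimizers, F would drop below its minimum.\<close>

lemma strictly_convex_minimizer_unique:
  assumes "strictly_convex F" and a: "\<And>c. F a \<le> F c" and b: "\<And>c. F b \<le> F c"
  shows "a = b"
proof (rule ccontr)
  assume "a \<noteq> b"
  then have "F ((1 - 1/2) *\<^sub>R a + (1/2) *\<^sub>R b) < (1 - 1/2) * F a + 1/2 * F b"
    using assms(1) unfolding strictly_convex_def
    by (metis field_sum_of_halves half_gt_zero less_add_same_cancel1 zero_less_one)
  then show False
    using a[of b] b[of a] a[of "(1 - 1/2) *\<^sub>R a + (1/2) *\<^sub>R b"] by simp
qed

lemma quadratic_lower_bound_attains_inf:
  fixes F :: "'a :: heine_borel \<Rightarrow> real"
  assumes "continuous_on UNIV F" "\<alpha> > 0"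
    and lower: "\<And>c. \<alpha> * (dist p c)\<^sup>2 \<le> F c"
  shows "\<exists>c. \<forall>c'. F c \<le> F c'"
proof -
  \<comment> \<open>With this radius the lower bound reaches \<open>F p\<close> on the sphere, so no
    point outside the compact ball beats its centre.\<close>
  define r where "r = sqrt (F p / \<alpha>)"
  have Fp: "F p \<ge> 0"
    using lower[of p] by simp
  have r: "r \<ge> 0" "\<alpha> * r\<^sup>2 = F p"
    using Fp \<open>\<alpha> > 0\<close> by (simp_all add: r_def)
  have "continuous_on (cball p r) F"
    using assms(1) continuous_on_subset by blast
  then obtain c where c: "\<And>c'. c' \<in> cball p r \<Longrightarrow> F c \<le> F c'"
    using continuous_attains_inf[of "cball p r" F] r(1) by fastforce
  have "F c \<le> F c'" for c'
  proof (cases "c' \<in> cball p r")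
    case False
    then have "r\<^sup>2 \<le> (dist p c')\<^sup>2"
      using r(1) by (intro power_mono) auto
    then have "F p \<le> F c'"
      using lower[of c'] r(2) \<open>\<alpha> > 0\<close> by (smt (verit) mult_left_mono)
    then show ?thesis
      using c[of p] r(1) by simp
  qed (use c in simp)
  then show ?thesis
    by blast
qed

lemma sum_max_zero_convex_combination:
  fixes g :: "'i \<Rightarrow> 'a :: real_normed_vector \<Rightarrow> real"
  assumes "finite I" "\<alpha> \<ge> 0" "0 \<le> t" "t \<le> 1"
    and g: "\<And>i. i \<in> I \<Longrightarrow> g i ((1 - t) *\<^sub>R a + t *\<^sub>R b) =
      (1 - t) * g i a + t * g i b - \<alpha> * (t * (1 - t) * (norm (a - b))\<^sup>2)"
    and pos: "(\<Sum>i\<in>I. g i ((1 - t) *\<^sub>R a + t *\<^sub>R b)) > 0"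
  shows "(\<Sum>i\<in>I. max 0 (g i ((1 - t) *\<^sub>R a + t *\<^sub>R b))) \<le>
    (1 - t) * (\<Sum>i\<in>I. max 0 (g i a)) + t * (\<Sum>i\<in>I. max 0 (g i b))
    - \<alpha> * (t * (1 - t) * (norm (a - b))\<^sup>2)"
proof -
  define c where "c = (1 - t) *\<^sub>R a + t *\<^sub>R b"
  define \<delta> where "\<delta> = \<alpha> * (t * (1 - t) * (norm (a - b))\<^sup>2)"
  obtain k where k: "k \<in> I" "g k c > 0"
    using pos sum_nonpos[of I "\<lambda>i. g i c"] unfolding c_def by (meson leD leI)
  have "\<delta> \<ge> 0"
    using assms by (simp add: \<delta>_def)
  \<comment> \<open>The whole deficit \<delta> is charged to the index k, where the maximum at c is
    \<open>g k c\<close> itself; every other term only needs \<delta> to be nonnegative.\<close>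
  have "max 0 (g i c) \<le> (1 - t) * max 0 (g i a) + t * max 0 (g i b) - (if i = k then \<delta> else 0)"
    if "i \<in> I" for i
  proof -
    have "(1 - t) * g i a \<le> (1 - t) * max 0 (g i a)" "t * g i b \<le> t * max 0 (g i b)"
      "0 \<le> (1 - t) * max 0 (g i a)" "0 \<le> t * max 0 (g i b)"
      using assms by (auto intro: mult_left_mono)
    then show ?thesis
      using g[OF that] k \<open>\<delta> \<ge> 0\<close> unfolding c_def[symmetric] \<delta>_def[symmetric]
      by (auto simp: max_def split: if_splits)
  qed
  then have "(\<Sum>i\<in>I. max 0 (g i c)) \<le>
      (\<Sum>i\<in>I. (1 - t) * max 0 (g i a) + t * max 0 (g i b) - (if i = k then \<delta> else 0))"
    by (rule sum_mono)
  also have "\<dots> = (1 - t) * (\<Sum>i\<in>I. max 0 (g i a)) + t * (\<Sum>i\<in>I. max 0 (g i b)) - \<delta>"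
    using k \<open>finite I\<close> by (simp add: sum_subtractf sum.distrib sum_distrib_left)
  finally show ?thesis
    unfolding c_def \<delta>_def .
qed

theorem mainTheorem1:
  fixes n :: nat and x :: "nat \<Rightarrow> real ^ 'd" and \<eta> \<eta>' :: real
    and F :: "real ^ 'd \<Rightarrow> real"
  assumes distinct: "\<exists>i\<in>{1..n}. \<exists>j\<in>{1..n}. x i \<noteq> x j"
    and eta: "0 < \<eta>" "\<eta> < 1 - 1 / real n"
    and F: "F = objective n x \<eta>"
    and eta': "\<eta>' = real n / (real n - 1) * \<eta>"
  shows "strongly_convex (2 * (1 - \<eta>')) F \<and>
         strictly_convex F \<and>
         (\<exists>!c. \<forall>c'. F c \<le> F c')"
proof -
  obtain p q where pq: "p \<in> {1..n}" "q \<in> {1..n}" "x p \<noteq> x q"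
    using distinct by blast
  then have n: "real n > 1"
    by (cases "p = q") auto
  \<comment> \<open>The upper bound on \<eta> is (n - 1)/n, the reciprocal of the factor that turns
    \<eta> into \<eta>'.\<close>
  then have \<alpha>: "1 - \<eta>' > 0"
    using eta(2) by (simp add: eta' field_simps)
  define S where "S c = (\<Sum>j = 1..n. (norm (x j - c))\<^sup>2)" for c
  define g where "g i c = (norm (x i - c))\<^sup>2 - \<eta> / (real n - 1) * S c" for i c
  have F_eq: "F c = (\<Sum>i = 1..n. max 0 (g i c))" for c
    by (simp add: F objective_def g_def S_def)
  have sum_g: "(\<Sum>i = 1..n. g i c) = (1 - \<eta>') * S c" for c
    unfolding g_def sum_subtractf S_def[symmetric] by (simp add: eta' algebra_simps)
  have S_ge: "(norm (x i - c))\<^sup>2 \<le> S c" if "i \<in> {1..n}" for i c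
    unfolding S_def using that by (intro member_le_sum) auto
  have S_pos: "S c > 0" for c
  proof -
    \<comment> \<open>A single c cannot coincide with two different points, so one of the squared
      distances in \<open>S c\<close> is positive.\<close>
    have "x p \<noteq> c \<or> x q \<noteq> c"
      using pq(3) by auto
    then show ?thesis
      using S_ge[OF pq(1), of c] S_ge[OF pq(2), of c] by (smt (verit) zero_less_norm_iff
          right_minus_eq zero_less_power)
  qed
  have sum_g_pos: "(\<Sum>i = 1..n. g i c) > 0" for c
    unfolding sum_g using \<alpha> S_pos by simp
  have S_comb: "S ((1 - t) *\<^sub>R a + t *\<^sub>R b) =
      (1 - t) * S a + t * S b - real n * (t * (1 - t) * (norm (a - b))\<^sup>2)" for a b t
    unfolding S_def norm_diff_sq_convex_combination
    by (simp add: sum_subtractf sum.distrib sum_distrib_left)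
  \<comment> \<open>The modulus is 1 from the point's own squared distance, less \<eta>/(n - 1)
    times the modulus n of S, which is \<eta>'.\<close>
  have g_comb: "g i ((1 - t) *\<^sub>R a + t *\<^sub>R b) =
      (1 - t) * g i a + t * g i b - (1 - \<eta>') * (t * (1 - t) * (norm (a - b))\<^sup>2)" for i a b t
    unfolding g_def S_comb norm_diff_sq_convex_combination eta' by (simp add: algebra_simps diff_divide_distrib)
  have comb: "F ((1 - t) *\<^sub>R a + t *\<^sub>R b) \<le> (1 - t) * F a + t * F b
      - (1 - \<eta>') * (t * (1 - t) * (norm (a - b))\<^sup>2)" if "0 < t" "t < 1" for a b t
    unfolding F_eq
    by (rule sum_max_zero_convex_combination[where g = g and \<alpha> = "1 - \<eta>'"];
        (rule g_comb sum_g_pos)?) (use that \<alpha> in auto)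
  have strict: "strictly_convex F"
    using \<alpha> by (intro strictly_convexI[OF _ comb]) auto
  \<comment> \<open>Dropping the truncation at 0 leaves the sum of the \<open>g i\<close>, a
    positive multiple of S, and S dominates its term at p.\<close>
  have lower: "(1 - \<eta>') * (dist (x p) c)\<^sup>2 \<le> F c" for c
  proof -
    have "(1 - \<eta>') * (dist (x p) c)\<^sup>2 \<le> (1 - \<eta>') * S c"
      using S_ge[OF pq(1)] \<alpha> by (simp add: dist_norm)
    also have "\<dots> \<le> F c"
      unfolding sum_g[symmetric] F_eq by (intro sum_mono) simp
    finally show ?thesis .
  qed
  have "continuous_on UNIV F"
    unfolding F_eq g_def S_def by (intro continuous_intros)
  then have "\<exists>c. \<forall>c'. F c \<le> F c'"
    using quadratic_lower_bound_attains_inf \<alpha> lower by blast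
  then have "\<exists>!c. \<forall>c'. F c \<le> F c'"
    using strictly_convex_minimizer_unique[OF strict] by blast
  moreover have "strongly_convex (2 * (1 - \<eta>')) F"
    using \<alpha> by (intro strongly_convexI[OF _ comb]) auto
  ultimately show ?thesis
    using strict by blast
qed

end
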